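(* Let $n,k$ be integers with $1\le k\le n$, and let $A\in\mathbb{R}^{(n-k+1)\times n}$ and $B\in\mathbb{R}^{n\times n}$ be the matrices of valid and circular convolution with a box of width $k$, respectively. Let $x\in\mathbb{R}^n$ satisfy $|\operatorname{supp}(x)|<\lfloor \frac{n}{k}\rfloor$. Then: (i) if $y=Ax$, then $x$ is the unique minimizer of $\|w\|_1$ among all $w\in\mathbb{R}^n$ with $Aw=y$; that is, $\|x'\|_1>\|x\|_1$ for every $x'\in\mathbb{R}^n$ with $Ax'=y$ and $x'\neq x$; (ii) if $y=Bx$, then $x$ is the unique minimizer of $\|w\|_1$ among all $w\in\mathbb{R}^n$ with $Bw=y$; that is, $\|x'\|_1>\|x\|_1$ for every $x'\in\mathbb{R}^n$ with $Bx'=y$ and $x'\neq x$.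
   Context: For $x\in\mathbb{R}^n$, $\operatorname{supp}(x)\subseteq\{1,\ldots,n\}$ is the set of indices where $x$ is nonzero, and $\|x\|_1=\sum_{i=1}^n|x_i|$. Valid convolution with a box of width $k$: $A$ is the $(n-k+1)\times n$ matrix with $(Ax)_i=x_i+x_{i+1}+\cdots+x_{i+k-1}$ for $1\le i\le n-k+1$. Circular convolution with a box of width $k$: $B$ is the $n\times n$ matrix with $(Bx)_i=\sum_{t=0}^{k-1}x_{i+t}$ for $1\le i\le n$, where indices are taken modulo $n$ with representatives in $\{1,\ldots,n\}$. (The first $n-k+1$ rows of $B$ are the rows of $A$.) *)

theory Defs
  imports Complex_Main "Jordan_Normal_Form.Matrix"
begin

text \<open>
  Vectors and matrices are indexed from 0, so the usual coordinates \<open>1, \<dots>, n\<close>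
  are \<open>0, \<dots>, n - 1\<close> here.
\<close>

definition supp :: "real vec \<Rightarrow> nat set" where
  "supp x = {i. i < dim_vec x \<and> x $ i \<noteq> 0}"

definition l1_norm :: "real vec \<Rightarrow> real" where
  "l1_norm x = (\<Sum>i<dim_vec x. \<bar>x $ i\<bar>)"

definition valid_conv :: "nat \<Rightarrow> nat \<Rightarrow> real mat" where
  "valid_conv n k = mat (n - k + 1) n (\<lambda>(i, j). if i \<le> j \<and> j < i + k then 1 else 0)"

definition circ_conv :: "nat \<Rightarrow> nat \<Rightarrow> real mat" where
  "circ_conv n k = mat n n (\<lambda>(i, j). \<Sum>t<k. if (i + t) mod n = j then 1 else 0)"

text \<open>The matrices act by the sums that characterise the two convolutions.\<close>

lemma valid_conv_mult_index:
  assumes "1 \<le> k" "k \<le> n" "x \<in> carrier_vec n" "i < n - k + 1"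
  shows "(valid_conv n k *\<^sub>v x) $ i = (\<Sum>t<k. x $ (i + t))"
proof -
  have "(valid_conv n k *\<^sub>v x) $ i
      = (\<Sum>j\<in>{0..<n}. (if i \<le> j \<and> j < i + k then 1 else 0) * x $ j)"
    using assms by (auto simp: valid_conv_def scalar_prod_def intro!: sum.cong)
  also have "\<dots> = (\<Sum>j\<in>{i..<i + k}. x $ j)"
    using assms by (intro sum.mono_neutral_cong_right) auto
  also have "\<dots> = (\<Sum>t<k. x $ (i + t))"
    by (rule sum.reindex_bij_witness[where i = "\<lambda>t. i + t" and j = "\<lambda>j. j - i"]) auto
  finally show ?thesis .
qed

lemma circ_conv_mult_index:
  assumes "x \<in> carrier_vec n" "i < n"
  shows "(circ_conv n k *\<^sub>v x) $ i = (\<Sum>t<k. x $ ((i + t) mod n))"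
proof -
  have "(circ_conv n k *\<^sub>v x) $ i
      = (\<Sum>j\<in>{0..<n}. \<Sum>t<k. (if (i + t) mod n = j then 1 else 0) * x $ j)"
    using assms by (auto simp: circ_conv_def scalar_prod_def sum_distrib_right intro!: sum.cong)
  also have "\<dots> = (\<Sum>t<k. \<Sum>j\<in>{0..<n}. if (i + t) mod n = j then x $ j else 0)"
    by (subst sum.swap) (auto intro!: sum.cong)
  also have "\<dots> = (\<Sum>t<k. x $ ((i + t) mod n))"
    using assms by (auto intro!: sum.cong)
  finally show ?thesis .
qed

end

theory Submission
  imports Defs
begin

text \<open>
  A vector \<open>z\<close> in the kernel of valid convolution is the \<open>k\<close>-periodic extension of its first \<open>k\<close>
  entries, and these sum to zero. Hence no entry of \<open>z\<close> exceeds half of their absolute sum \<open>V\<close>,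
  while the \<open>\<lfloor>n / k\<rfloor>\<close> full periods give \<open>z\<close> an \<open>\<ell>\<^sub>1\<close> norm of at least \<open>\<lfloor>n / k\<rfloor> * V\<close>. So fewer than
  \<open>\<lfloor>n / k\<rfloor>\<close> entries carry less than half of the norm (the null space property), which yields
  uniqueness of sparse minimizers. The rows of the valid convolution are rows of the circular one,
  so the circular case follows from the valid one.
\<close>

text \<open>Windows starting at \<open>j\<close> and \<open>Suc j\<close> share all but their end
  entries, so when both sums vanish, \<open>z j = z (j + k)\<close>. Induction then lowers any index
  in steps of \<open>k\<close>.\<close>

lemma window_sums_zero_periodic:
  fixes z :: "nat \<Rightarrow> 'a::ab_group_add"
  assumes win: "\<And>i. i + k \<le> n \<Longrightarrow> (\<Sum>t<k. z (i + t)) = 0"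
    and "i < n"
  shows "z i = z (i mod k)"
  using \<open>i < n\<close>
proof (induction i rule: less_induct)
  case (less i)
  show ?case
  proof (cases "i < k \<or> k = 0")
    case True
    \<comment> \<open>The value \<open>k = 0\<close> fits here because
      \<open>i mod 0 = i\<close>.\<close>
    then show ?thesis by auto
  next
    case False
    define j where "j = i - k"
    have j: "i = j + k" "j < i" using False by (auto simp: j_def)
    have "z j + (\<Sum>t<k. z (Suc j + t)) = (\<Sum>t<Suc k. z (j + t))"
      by (subst sum.lessThan_Suc_shift) simp
    also have "\<dots> = (\<Sum>t<k. z (j + t)) + z (j + k)" by simp
    finally have "z j = z i" using win[of j] win[of "Suc j"] less.prems j by simp
    then show ?thesis using less.IH[of j] less.prems j by simp
  qed
qed

text \<open>In a zero-sum family each entry is minus the sum of the others, so the triangle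
  inequality bounds it by the rest of the absolute sum.\<close>

lemma abs_le_half_sum_abs:
  fixes v :: "'a \<Rightarrow> real"
  assumes "finite K" "sum v K = 0" "r \<in> K"
  shows "2 * \<bar>v r\<bar> \<le> (\<Sum>i\<in>K. \<bar>v i\<bar>)"
proof -
  have "v r = - sum v (K - {r})"
    using assms by (simp add: sum.remove)
  then have "\<bar>v r\<bar> \<le> (\<Sum>i\<in>K - {r}. \<bar>v i\<bar>)"
    by (simp add: sum_abs)
  then show ?thesis using assms by (simp add: sum.remove)
qed

lemma null_space_property:
  fixes z :: "nat \<Rightarrow> real"
  assumes k: "1 \<le> k"
    and win: "\<And>i. i + k \<le> n \<Longrightarrow> (\<Sum>t<k. z (i + t)) = 0"
    and S: "S \<subseteq> {..<n}" "card S < n div k"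
    and nz: "\<exists>i<n. z i \<noteq> 0"
  shows "2 * (\<Sum>i\<in>S. \<bar>z i\<bar>) < (\<Sum>i<n. \<bar>z i\<bar>)"
proof -
  define V where "V = (\<Sum>r<k. \<bar>z r\<bar>)"
  have kn: "k \<le> n"
    \<comment> \<open>For \<open>n < k\<close> the bound \<open>n div k\<close> would be 0, and no
      cardinality lies below that.\<close>
    using S(2) by (metis div_less gr_implies_not0 not_less)
  have per: "z i = z (i mod k)" if "i < n" for i
    using window_sums_zero_periodic[OF win that] .
  have sum0: "(\<Sum>t<k. z t) = 0" using win[of 0] kn by simp
  have le: "2 * \<bar>z i\<bar> \<le> V" if "i < n" for i
    using abs_le_half_sum_abs[OF _ sum0, of "i mod k"] per[OF that] k by (simp add: V_def)
  have "V > 0" using nz le by (metis less_le_trans zero_less_abs_iff zero_less_mult_iff zero_less_numeral)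
  have "2 * (\<Sum>i\<in>S. \<bar>z i\<bar>) = (\<Sum>i\<in>S. 2 * \<bar>z i\<bar>)" by (simp add: sum_distrib_left)
  also have "\<dots> \<le> real (card S) * V"
    using sum_bounded_above[of S "\<lambda>i. 2 * \<bar>z i\<bar>" V] le S(1) by auto
  also have "\<dots> < real (n div k) * V" using \<open>V > 0\<close> S(2) by simp
  \<comment> \<open>Each full period inside the range has absolute sum \<open>V\<close>.\<close>
  also have "\<dots> = (\<Sum>m<n div k. \<Sum>i = m * k..<m * k + k. \<bar>z i\<bar>)"
  proof -
    have "(\<Sum>i = m * k..<m * k + k. \<bar>z i\<bar>) = V" if m: "m < n div k" for m
    proof -
      have "Suc m * k \<le> n div k * k" using m by (intro mult_right_mono) auto
      then have mk: "m * k + k \<le> n" using div_times_less_eq_dividend[of n k] by (metis add.commute mult_Suc order_trans)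
      have "(\<Sum>i = m * k..<m * k + k. \<bar>z i\<bar>) = (\<Sum>t<k. \<bar>z (m * k + t)\<bar>)"
        by (rule sum.reindex_bij_witness[where i = "\<lambda>t. m * k + t" and j = "\<lambda>j. j - m * k"]) auto
      also have "\<dots> = V" unfolding V_def
        using mk per[of "m * k + _"] by (intro sum.cong) auto
      finally show ?thesis .
    qed
    then show ?thesis by simp
  qed
  also have "\<dots> = (\<Sum>i<n div k * k. \<bar>z i\<bar>)" by (rule sum.nat_group)
  \<comment> \<open>The \<open>n mod k\<close> entries after the last full period can only add to
    the norm.\<close>
  also have "\<dots> \<le> (\<Sum>i<n. \<bar>z i\<bar>)"
    by (intro sum_mono2) (auto intro: less_le_trans[OF _ div_times_less_eq_dividend])
  finally show ?thesis .
qed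

lemma valid_conv_unique_minimizer:
  assumes k: "1 \<le> k" and kn: "k \<le> n"
    and x: "x \<in> carrier_vec n" and sparse: "card (supp x) < n div k"
    and x': "x' \<in> carrier_vec n" "x' \<noteq> x"
    and eq: "valid_conv n k *\<^sub>v x' = valid_conv n k *\<^sub>v x"
  shows "l1_norm x < l1_norm x'"
proof -
  define z where "z i = x' $ i - x $ i" for i
  let ?S = "supp x"
  have S: "?S \<subseteq> {..<n}" using x by (auto simp: supp_def)
  have win: "(\<Sum>t<k. z (i + t)) = 0" if "i + k \<le> n" for i
  proof -
    have "i < n - k + 1" using that by simp
    from valid_conv_mult_index[OF k kn x this] valid_conv_mult_index[OF k kn x'(1) this]
    show ?thesis using eq by (simp add: z_def sum_subtractf)
  qed
  have nz: "\<exists>i<n. z i \<noteq> 0" using x x' by (auto simp: z_def vec_eq_iff)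
  have split: "sum f {..<n} = sum f ({..<n} - ?S) + sum f ?S" for f :: "nat \<Rightarrow> real"
    using sum.subset_diff[OF S] by simp
  have zero: "x $ i = 0" if "i \<in> {..<n} - ?S" for i
    using that x by (auto simp: supp_def)
  have "(\<Sum>i<n. \<bar>x $ i\<bar>) = (\<Sum>i\<in>?S. \<bar>x $ i\<bar>)" using zero by (simp add: split)
  also have "\<dots> \<le> (\<Sum>i\<in>?S. \<bar>x' $ i\<bar> + \<bar>z i\<bar>)"
    by (intro sum_mono) (auto simp: z_def)
  \<comment> \<open>Off the support \<open>x\<close> vanishes, so \<open>z\<close> agrees with
    \<open>x'\<close> there. Hence the part of the norm of \<open>x'\<close> on \<open>?S\<close> is
    its whole norm minus the part of the norm of \<open>z\<close> off \<open>?S\<close>.\<close>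
  also have "\<dots> = (\<Sum>i<n. \<bar>x' $ i\<bar>) + 2 * (\<Sum>i\<in>?S. \<bar>z i\<bar>) - (\<Sum>i<n. \<bar>z i\<bar>)"
    using zero by (simp add: split sum.distrib z_def)
  also have "\<dots> < (\<Sum>i<n. \<bar>x' $ i\<bar>)"
    using null_space_property[OF k win S sparse nz] by simp
  finally show ?thesis using x x'(1) by (simp add: l1_norm_def)
qed

text \<open>The first \<open>n - k + 1\<close> circular windows do not wrap around: their indices
  stay below \<open>n\<close>, where \<open>mod n\<close> is the identity.\<close>

lemma circ_conv_eq_imp_valid_conv_eq:
  assumes k: "1 \<le> k" "k \<le> n" and x: "x \<in> carrier_vec n" "x' \<in> carrier_vec n"
    and eq: "circ_conv n k *\<^sub>v x' = circ_conv n k *\<^sub>v x"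
  shows "valid_conv n k *\<^sub>v x' = valid_conv n k *\<^sub>v x"
proof (rule eq_vecI)
  fix i assume "i < dim_vec (valid_conv n k *\<^sub>v x)"
  then have i: "i < n - k + 1" by (simp add: valid_conv_def)
  then have "i < n" using k by simp
  have "(valid_conv n k *\<^sub>v w) $ i = (circ_conv n k *\<^sub>v w) $ i" if w: "w \<in> carrier_vec n" for w
    unfolding valid_conv_mult_index[OF k w i] circ_conv_mult_index[OF w \<open>i < n\<close>]
    using i k by (intro sum.cong) auto
  then show "(valid_conv n k *\<^sub>v x') $ i = (valid_conv n k *\<^sub>v x) $ i" using x eq by simp
qed (simp add: valid_conv_def)

theorem theorem1:
  fixes n k :: nat and x :: "real vec"
  assumes "1 \<le> k" and "k \<le> n"
    and "x \<in> carrier_vec n"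
    and "int (card (supp x)) < \<lfloor>real n / real k\<rfloor>"
  shows "(\<forall>y. y = valid_conv n k *\<^sub>v x \<longrightarrow>
            (\<forall>x'\<in>carrier_vec n. valid_conv n k *\<^sub>v x' = y \<and> x' \<noteq> x \<longrightarrow> l1_norm x' > l1_norm x))
       \<and> (\<forall>y. y = circ_conv n k *\<^sub>v x \<longrightarrow>
            (\<forall>x'\<in>carrier_vec n. circ_conv n k *\<^sub>v x' = y \<and> x' \<noteq> x \<longrightarrow> l1_norm x' > l1_norm x))"
proof -
  have "card (supp x) < n div k"
    using assms(4) by (simp add: floor_divide_of_nat_eq)
  then show ?thesis
    using valid_conv_unique_minimizer circ_conv_eq_imp_valid_conv_eq assms(1-3) by blast
qed

end
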